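(* For every $c>0$ there exists a constant $A>0$ depending only on $c$ such that for every real $\alpha\geq-\frac12$ and every integer $n\geq 0$ with $n>\frac{ec}{4}$, $$\lambda_{n}^{\alpha}(c)\leq A\left(\frac{ec}{4n+2\alpha+5}\right)^{2n+\alpha+1},$$ where $e$ is the base of the natural logarithm.
   Context: $J_\alpha$ denotes the Bessel function of the first kind of order $\alpha$, $J_{\alpha}(x)=\sum_{m=0}^{\infty}\frac{(-1)^m}{m!}\frac{(x/2)^{2m+\alpha}}{\Gamma(m+\alpha+1)}$. For $c>0$, the finite Hankel transform operator $\mathcal H_c^{\alpha}$ is the integral operator on $L^2(0,1)$ given by $\mathcal H_c^{\alpha}f(x)=\int_0^1\sqrt{cxy}\,J_\alpha(cxy)f(y)\,dy$. The operator $\mathcal Q_c^{\alpha}=c\,\mathcal H_c^{\alpha}\mathcal H_c^{\alpha}$ is a positive, self-adjoint, compact operator on $L^2(0,1)$. Its infinite, countable sequence of eigenvalues, arranged in decreasing order and counted with multiplicity, is denoted $(\lambda_n^{\alpha}(c))_{n\geq 0}$. *)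

theory Defs
  imports "HOL-Analysis.Analysis" "HOL-Library.Equipollence"
begin

text \<open>
  \<open>L2_01\<close> below is the real space of square integrable functions on \<open>(0, 1)\<close>, modulo equality
  almost everywhere. The operators have real kernels and are self-adjoint, so real scalars give the
  same eigenvalues and multiplicities as complex ones.
\<close>

abbreviation lebesgue_01 :: "real measure" where
  "lebesgue_01 \<equiv> lebesgue_on {0<..<1}"

definition square_integrable_01 :: "(real \<Rightarrow> real) \<Rightarrow> bool" where
  "square_integrable_01 f \<longleftrightarrow>
     f \<in> borel_measurable lebesgue_01 \<and> integrable lebesgue_01 (\<lambda>x. (f x)\<^sup>2)"

lemma square_integrable_01_zero: "square_integrable_01 (\<lambda>x. 0)"
  by (simp add: square_integrable_01_def)

lemma square_integrable_01_cmult: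
  "square_integrable_01 f \<Longrightarrow> square_integrable_01 (\<lambda>x. a * f x)"
  by (auto simp: square_integrable_01_def power_mult_distrib intro: borel_measurable_times)

lemma square_integrable_01_uminus:
  "square_integrable_01 f \<Longrightarrow> square_integrable_01 (\<lambda>x. - f x)"
  by (simp add: square_integrable_01_def)

lemma square_integrable_01_add:
  assumes "square_integrable_01 f" "square_integrable_01 g"
  shows "square_integrable_01 (\<lambda>x. f x + g x)"
proof -
  have [measurable]: "f \<in> borel_measurable lebesgue_01" "g \<in> borel_measurable lebesgue_01"
    using assms by (auto simp: square_integrable_01_def)
  have "integrable lebesgue_01 (\<lambda>x. 2 * (f x)\<^sup>2 + 2 * (g x)\<^sup>2)"
    using assms by (auto simp: square_integrable_01_def)
  moreover have "(f x + g x)\<^sup>2 \<le> 2 * (f x)\<^sup>2 + 2 * (g x)\<^sup>2" for x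
    using zero_le_power2[of "f x - g x"] by (simp add: power2_sum power2_diff)
  ultimately have "integrable lebesgue_01 (\<lambda>x. (f x + g x)\<^sup>2)"
    by (elim Bochner_Integration.integrable_bound) auto
  then show ?thesis
    by (simp add: square_integrable_01_def)
qed

lemma square_integrable_01_diff:
  assumes "square_integrable_01 f" "square_integrable_01 g"
  shows "square_integrable_01 (\<lambda>x. f x - g x)"
  using square_integrable_01_add[OF assms(1) square_integrable_01_uminus[OF assms(2)]] by simp

definition ae_eq_01 :: "(real \<Rightarrow> real) \<Rightarrow> (real \<Rightarrow> real) \<Rightarrow> bool" where
  "ae_eq_01 f g \<longleftrightarrow> square_integrable_01 f \<and> square_integrable_01 g \<and>
     (AE x in lebesgue_01. f x = g x)"

lemma part_equivp_ae_eq_01: "part_equivp ae_eq_01"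
proof (rule part_equivpI)
  show "\<exists>f. ae_eq_01 f f"
    using square_integrable_01_zero by (auto simp: ae_eq_01_def)
  show "symp ae_eq_01"
    by (auto simp: symp_def ae_eq_01_def elim: AE_mp)
  show "transp ae_eq_01"
    by (auto simp: transp_def ae_eq_01_def elim: AE_mp)
qed

quotient_type L2_01 = "real \<Rightarrow> real" / partial: ae_eq_01
  by (rule part_equivp_ae_eq_01)

instantiation L2_01 :: real_vector
begin

lift_definition zero_L2_01 :: L2_01 is "\<lambda>x. 0"
  by (simp add: ae_eq_01_def square_integrable_01_zero)

lift_definition plus_L2_01 :: "L2_01 \<Rightarrow> L2_01 \<Rightarrow> L2_01" is "\<lambda>f g x. f x + g x"
  by (auto simp: ae_eq_01_def intro: square_integrable_01_add elim: AE_mp)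

lift_definition minus_L2_01 :: "L2_01 \<Rightarrow> L2_01 \<Rightarrow> L2_01" is "\<lambda>f g x. f x - g x"
  by (auto simp: ae_eq_01_def intro: square_integrable_01_diff elim: AE_mp)

lift_definition uminus_L2_01 :: "L2_01 \<Rightarrow> L2_01" is "\<lambda>f x. - f x"
  by (auto simp: ae_eq_01_def intro: square_integrable_01_uminus elim: AE_mp)

lift_definition scaleR_L2_01 :: "real \<Rightarrow> L2_01 \<Rightarrow> L2_01" is "\<lambda>a f x. a * f x"
  by (auto simp: ae_eq_01_def intro: square_integrable_01_cmult elim: AE_mp)

instance
  by standard
    (transfer; auto simp: ae_eq_01_def algebra_simps
       intro: square_integrable_01_zero square_integrable_01_add square_integrable_01_diff
         square_integrable_01_uminus square_integrable_01_cmult)+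

end

definition eigenspace :: "('a::real_vector \<Rightarrow> 'a) \<Rightarrow> real \<Rightarrow> 'a set" where
  "eigenspace T \<mu> = {f. T f = \<mu> *\<^sub>R f}"

text \<open>
  Every real \<open>\<mu>\<close> occurs in the sequence exactly as often as the dimension of its eigenspace says
  (so not at all if \<open>\<mu>\<close> is not an eigenvalue: then the eigenspace is trivial and \<open>B\<close> is empty).
  Dimensions are compared through the cardinality of a basis, since \<^const>\<open>dim\<close> is \<open>0\<close> on
  infinite-dimensional spaces. The sequence is uniquely determined by this property.
\<close>

definition eigenvalue_sequence :: "('a::real_vector \<Rightarrow> 'a) \<Rightarrow> (nat \<Rightarrow> real) \<Rightarrow> bool" where
  "eigenvalue_sequence T ev \<longleftrightarrow> decseq ev \<and>
     (\<forall>\<mu>. \<exists>B. independent B \<and> span B = eigenspace T \<mu> \<and> {n. ev n = \<mu>} \<approx> B)"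

text \<open>
  Only used for \<open>x > 0\<close>; at \<open>x = 0\<close> the convention \<open>0 powr a = 0\<close> would give \<open>J\<^sub>0(0) = 0\<close>.
\<close>

definition bessel_J :: "real \<Rightarrow> real \<Rightarrow> real" where
  "bessel_J \<alpha> x =
     (\<Sum>m. (-1) ^ m / fact m * ((x / 2) powr (2 * real m + \<alpha>) / Gamma (real m + \<alpha> + 1)))"

definition hankel_integral :: "real \<Rightarrow> real \<Rightarrow> (real \<Rightarrow> real) \<Rightarrow> real \<Rightarrow> real" where
  "hankel_integral c \<alpha> f x =
     (LINT y|lebesgue_01. sqrt (c * x * y) * bessel_J \<alpha> (c * x * y) * f y)"

text \<open>
  The operator on classes: by the following lemma the choice of the representative is immaterial.
  For \<open>c > 0\<close> and \<open>\<alpha> \<ge> -1/2\<close> the kernel is bounded, so the image is again square integrable;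
  for other parameters \<^const>\<open>abs_L2_01\<close> may be applied to a function outside its domain.
\<close>

lemma hankel_integral_cong_AE:
  assumes "ae_eq_01 f g"
  shows "hankel_integral c \<alpha> f = hankel_integral c \<alpha> g"
proof
  fix x
  let ?k = "\<lambda>y. sqrt (c * x * y) * bessel_J \<alpha> (c * x * y)"
  have [measurable]: "?k \<in> borel_measurable lebesgue_01"
  proof -
    have "(\<lambda>y. sqrt (c * x * y) * bessel_J \<alpha> (c * x * y)) \<in> borel_measurable borel"
      unfolding bessel_J_def by measurable
    then show ?thesis
      by (intro measurable_restrict_space1 measurable_completion) simp
  qed
  have [measurable]: "f \<in> borel_measurable lebesgue_01" "g \<in> borel_measurable lebesgue_01"
    using assms by (auto simp: ae_eq_01_def square_integrable_01_def)
  show "hankel_integral c \<alpha> f x = hankel_integral c \<alpha> g x"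
    unfolding hankel_integral_def
  proof (rule integral_cong_AE)
    have "AE y in lebesgue_01. f y = g y"
      using assms by (simp add: ae_eq_01_def)
    then show "AE y in lebesgue_01. ?k y * f y = ?k y * g y"
      by eventually_elim simp
  qed simp_all
qed

definition finite_hankel :: "real \<Rightarrow> real \<Rightarrow> L2_01 \<Rightarrow> L2_01" where
  "finite_hankel c \<alpha> f = abs_L2_01 (hankel_integral c \<alpha> (rep_L2_01 f))"

definition hankel_Q :: "real \<Rightarrow> real \<Rightarrow> L2_01 \<Rightarrow> L2_01" where
  "hankel_Q c \<alpha> f = c *\<^sub>R finite_hankel c \<alpha> (finite_hankel c \<alpha> f)"

end

theory Submission
  imports Defs "HOL-Real_Asymp.Real_Asymp"
begin

text \<open>
  If \<open>f\<close> is orthogonal to \<open>y\<^bsup>2m+\<alpha>+1/2\<^esup>\<close> for \<open>m < n\<close>, the first \<open>n\<close> terms of the Bessel series drop out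
  of \<open>\<H>f\<close>, so \<open>\<parallel>\<H>f\<parallel>\<close> is at most \<open>\<parallel>f\<parallel>\<close> times the supremum of the remainder of the kernel, which is
  of order \<open>(c/2)\<^bsup>2n+\<alpha>+1/2\<^esup> / (n! \<Gamma>(n+\<alpha>+1))\<close>. By the min-max principle \<open>\<lambda>\<^sub>n\<close> is at most \<open>c\<close> times the
  square of this. Log-convexity gives \<open>n! \<Gamma>(n+\<alpha>+1) \<ge> \<Gamma>(s)\<^sup>2\<close> with \<open>s = n+1+\<alpha>/2\<close>; as
  \<open>2n+\<alpha>+1 = 2s-1\<close> and \<open>4n+2\<alpha>+5 = 4s+1\<close>, the claim becomes the boundedness of a function of \<open>s\<close>
  alone, and it holds since \<open>\<Gamma>(s)\<^sup>4\<close> outgrows \<open>(4s+1)\<^bsup>2s-1\<^esup> K\<^sup>s\<close> for every \<open>K\<close>.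
\<close>

section \<open>Linear algebra: bounding the n-th eigenvalue from above\<close>

text \<open>Gaussian elimination, by induction on the number of equations. If the last equation
  involves some unknown j, solving it for j and substituting into the others leaves n equations in
  one unknown fewer. The index set is arbitrary so that j can be deleted from it.\<close>

lemma homogeneous_system_nontrivial:
  fixes u :: "nat \<Rightarrow> 'b \<Rightarrow> real"
  assumes "finite I" "n < card I"
  shows "\<exists>a. (\<exists>i\<in>I. a i \<noteq> 0) \<and> (\<forall>m<n. (\<Sum>i\<in>I. a i * u m i) = 0)"
  using assms
proof (induction n arbitrary: I u)
  case 0
  then have "I \<noteq> {}" by auto
  then show ?case by (intro exI[of _ "\<lambda>_. 1"]) auto
next
  case (Suc n)
  show ?case
  proof (cases "\<forall>i\<in>I. u n i = 0")
    case True
    obtain a where a: "\<exists>i\<in>I. a i \<noteq> 0" "\<forall>m<n. (\<Sum>i\<in>I. a i * u m i) = 0"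
      using Suc.IH[of I u] Suc.prems by auto
    moreover have "(\<Sum>i\<in>I. a i * u n i) = 0"
      using True by (intro sum.neutral) auto
    ultimately show ?thesis
      by (intro exI[of _ a]) (auto simp: less_Suc_eq)
  next
    case False
    then obtain j where j: "j \<in> I" "u n j \<noteq> 0" by blast
    let ?I = "I - {j}"
    have fin: "finite ?I" "n < card ?I"
      using Suc.prems j by auto
    obtain a where a: "\<exists>i\<in>?I. a i \<noteq> 0"
        "\<forall>m<n. (\<Sum>i\<in>?I. a i * (u m i - u m j / u n j * u n i)) = 0"
      using Suc.IH[OF fin, of "\<lambda>m i. u m i - u m j / u n j * u n i"] by auto
    define S where "S = (\<Sum>i\<in>?I. a i * u n i)"
    \<comment> \<open>The value at j is the one that equation n forces, given the other
      unknowns.\<close>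
    define b where "b = a(j := - S / u n j)"
    have split: "(\<Sum>i\<in>I. b i * u m i) = (\<Sum>i\<in>?I. a i * u m i) - u m j / u n j * S" for m
    proof -
      have "(\<Sum>i\<in>?I. b i * u m i) = (\<Sum>i\<in>?I. a i * u m i)"
        by (intro sum.cong) (auto simp: b_def)
      then show ?thesis
        using sum.remove[OF Suc.prems(1) j(1), of "\<lambda>i. b i * u m i"]
        by (simp add: b_def)
    qed
    have "(\<Sum>i\<in>?I. a i * u m i) - u m j / u n j * S
        = (\<Sum>i\<in>?I. a i * (u m i - u m j / u n j * u n i))" for m
      by (simp add: S_def sum_distrib_left sum_subtractf algebra_simps)
    with split a(2) have "\<forall>m<n. (\<Sum>i\<in>I. b i * u m i) = 0"
      by simp
    moreover have "(\<Sum>i\<in>I. b i * u n i) = 0"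
      using split[of n] j(2) by (simp add: S_def)
    moreover have "\<exists>i\<in>I. b i \<noteq> 0"
      using a(1) by (auto simp: b_def)
    ultimately show ?thesis
      by (intro exI[of _ b]) (auto simp: less_Suc_eq)
  qed
qed

text \<open>One half of the min-max principle. The eigenvectors belonging to the indices 0, ..., n
  span a space of dimension n + 1, so it contains a nonzero f on which all n functionals vanish. The
  Rayleigh quotient of f is at least \<open>ev n\<close>, since the sequence decreases, and at most
  K by \<open>bound\<close>.\<close>

lemma eigenvalue_sequence_le:
  fixes T :: "'a::real_inner \<Rightarrow> 'a" and \<phi> :: "nat \<Rightarrow> 'a \<Rightarrow> real"
  assumes T: "linear T" and sym: "\<And>f g. inner (T f) g = inner f (T g)"
    and ev: "eigenvalue_sequence T ev"
    and \<phi>: "\<And>m. linear (\<phi> m)"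
    and bound: "\<And>f. (\<And>m. m < n \<Longrightarrow> \<phi> m f = 0) \<Longrightarrow> inner (T f) f \<le> K * inner f f"
  shows "ev n \<le> K"
proof -
  have dec: "decseq ev"
    using ev by (simp add: eigenvalue_sequence_def)
  obtain B where B: "\<And>\<mu>. independent (B \<mu>)" "\<And>\<mu>. span (B \<mu>) = eigenspace T \<mu>"
      "\<And>\<mu>. {n. ev n = \<mu>} \<approx> B \<mu>"
    using ev unfolding eigenvalue_sequence_def by metis
  then obtain h where h: "\<And>\<mu>. bij_betw (h \<mu>) {n. ev n = \<mu>} (B \<mu>)"
    unfolding eqpoll_def by metis
  \<comment> \<open>The bijection for each eigenvalue labels a basis of its eigenspace by the
    indices at which that eigenvalue occurs, so \<open>e\<close> lists eigenvectors with
    multiplicity, in the order of \<open>ev\<close>.\<close>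
  define e where "e k = h (ev k) k" for k
  have eB: "e k \<in> B (ev k)" for k
    using bij_betwE[OF h[of "ev k"]] by (auto simp: e_def)
  have Te: "T (e k) = ev k *\<^sub>R e k" for k
    using span_base[OF eB[of k]] B(2)[of "ev k"] by (auto simp: eigenspace_def)
  obtain a where a: "\<exists>i\<in>{..n}. a i \<noteq> 0" "\<forall>m<n. (\<Sum>i\<le>n. a i * \<phi> m (e i)) = 0"
    using homogeneous_system_nontrivial[of "{..n}" n "\<lambda>m i. \<phi> m (e i)"] by auto
  define f where "f = (\<Sum>k\<le>n. a k *\<^sub>R e k)"
  \<comment> \<open>\<open>F \<mu>\<close> is the component of f in the eigenspace of \<mu>. The
    given bases need not be orthogonal, but distinct eigenspaces are, so the quadratic forms are
    computed from these components.\<close>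
  define F where "F \<mu> = (\<Sum>k | k \<le> n \<and> ev k = \<mu>. a k *\<^sub>R e k)" for \<mu>
  define S where "S = ev ` {..n}"
  have fin: "finite S" by (simp add: S_def)
  have f: "f = (\<Sum>\<mu>\<in>S. F \<mu>)"
    unfolding f_def F_def S_def
    by (subst sum.image_gen[where g = ev]) (auto intro!: sum.cong)
  have TF: "T (F \<mu>) = \<mu> *\<^sub>R F \<mu>" for \<mu>
    unfolding F_def scaleR_sum_right linear_sum[OF T]
    by (intro sum.cong) (auto simp: linear_scale[OF T] Te)
  have FF: "inner (F \<mu>) (F \<nu>) = 0" if "\<mu> \<noteq> \<nu>" for \<mu> \<nu>
    using sym[of "F \<mu>" "F \<nu>"] that by (simp add: TF)
  \<comment> \<open>The weight 1 yields \<open>inner f f\<close>, the weight \<mu> yields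
    \<open>inner (T f) f\<close>.\<close>
  have diag: "(\<Sum>\<mu>\<in>S. \<Sum>\<nu>\<in>S. w \<mu> * inner (F \<mu>) (F \<nu>)) = (\<Sum>\<mu>\<in>S. w \<mu> * inner (F \<mu>) (F \<mu>))"
    for w
  proof (rule sum.cong[OF refl])
    fix \<mu> assume "\<mu> \<in> S"
    then show "(\<Sum>\<nu>\<in>S. w \<mu> * inner (F \<mu>) (F \<nu>)) = w \<mu> * inner (F \<mu>) (F \<mu>)"
      using fin FF by (subst sum.remove[of S \<mu>]) (auto intro!: sum.neutral)
  qed
  have ff: "inner f f = (\<Sum>\<mu>\<in>S. inner (F \<mu>) (F \<mu>))"
    using diag[of "\<lambda>_. 1"] unfolding f inner_sum_left by (simp add: inner_sum_right)
  have "T f = (\<Sum>\<mu>\<in>S. \<mu> *\<^sub>R F \<mu>)"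
    unfolding f linear_sum[OF T] by (simp add: TF)
  then have "inner (T f) f = (\<Sum>\<mu>\<in>S. \<Sum>\<nu>\<in>S. \<mu> * inner (F \<mu>) (F \<nu>))"
    unfolding f by (simp only: inner_sum_left) (simp add: inner_sum_right sum_distrib_left)
  then have Tff: "inner (T f) f = (\<Sum>\<mu>\<in>S. \<mu> * inner (F \<mu>) (F \<mu>))"
    using diag[of "\<lambda>\<mu>. \<mu>"] by simp
  have "ev n * inner f f \<le> inner (T f) f"
    unfolding ff Tff sum_distrib_left using dec
    by (intro sum_mono mult_right_mono) (auto simp: S_def decseq_def)
  moreover have "inner (T f) f \<le> K * inner f f"
  proof (rule bound)
    fix m assume "m < n"
    then show "\<phi> m f = 0"
      using a(2) by (simp add: f_def linear_sum[OF \<phi>] linear_scale[OF \<phi>])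
  qed
  \<comment> \<open>If f were 0, orthogonality would make every component vanish. The component
    containing an index i with \<open>a i \<noteq> 0\<close> would then be a vanishing combination
    of distinct basis vectors with a nonzero coefficient, against independence.\<close>
  moreover have "inner f f > 0"
  proof (rule ccontr)
    assume "\<not> inner f f > 0"
    then have "inner f f = 0"
      using inner_ge_zero[of f] by linarith
    then have F0: "F \<mu> = 0" if "\<mu> \<in> S" for \<mu>
      using that fin by (simp add: ff sum_nonneg_eq_0_iff)
    obtain i where i: "i \<le> n" "a i \<noteq> 0"
      using a(1) by auto
    let ?I = "{k. k \<le> n \<and> ev k = ev i}"
    have inj: "inj_on (h (ev i)) ?I"
      using h[of "ev i"] by (auto simp: bij_betw_def inj_on_def)
    have "F (ev i) = (\<Sum>k\<in>?I. a k *\<^sub>R h (ev i) k)"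
      unfolding F_def by (intro sum.cong) (auto simp: e_def)
    also have "\<dots> = (\<Sum>b\<in>h (ev i) ` ?I. a (the_inv_into ?I (h (ev i)) b) *\<^sub>R b)"
      using inj by (subst sum.reindex) (auto simp: the_inv_into_f_f intro!: sum.cong)
    finally have "(\<Sum>b\<in>h (ev i) ` ?I. a (the_inv_into ?I (h (ev i)) b) *\<^sub>R b) = 0"
      using F0[of "ev i"] i(1) by (simp add: S_def)
    moreover have "h (ev i) ` ?I \<subseteq> B (ev i)"
      using bij_betwE[OF h[of "ev i"]] by auto
    ultimately have "a (the_inv_into ?I (h (ev i)) (h (ev i) i)) = 0"
      using i(1) by (intro independentD[OF B(1)[of "ev i"], of "h (ev i) ` ?I"]) auto
    then show False
      using the_inv_into_f_f[OF inj, of i] i by simp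
  qed
  ultimately show ?thesis
    by (meson mult_le_cancel_right_pos order_trans)
qed

section \<open>Lower bounds for the Gamma function\<close>

text \<open>Euler's integral for \<open>Gamma (s + 1)\<close> is restricted to t \<ge> s, where
  \<open>t powr s\<close> is at least \<open>s powr s\<close>; dividing by s gives the
  claim.\<close>

lemma Gamma_ge_powr:
  fixes s :: real
  assumes "s > 0"
  shows "s powr (s - 1) * exp (- s) \<le> Gamma s"
proof -
  have 1: "((\<lambda>t. s powr s * exp (- t)) has_integral s powr s * exp (- s)) {s..}"
    using has_integral_mult_right[OF has_integral_exp_minus_to_infinity[of 1 s]] by simp
  have 2: "((\<lambda>t. t powr s / exp t) has_integral Gamma (s + 1)) {0..}"
    using assms Gamma_integral_real[of "s + 1"] by simp
  have "((\<lambda>t. if t \<in> {s..} then s powr s * exp (- t) else 0)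
          has_integral s powr s * exp (- s)) {0..}"
    using 1 assms by (subst has_integral_restrict) auto
  then have "s powr s * exp (- s) \<le> Gamma (s + 1)"
    by (rule has_integral_le[OF _ 2])
       (use assms in \<open>auto simp: exp_minus divide_inverse intro!: mult_right_mono powr_mono2\<close>)
  also have "Gamma (s + 1) = s * Gamma s"
    using assms by (intro Gamma_plus1) (auto elim!: nonpos_Ints_cases)
  finally show ?thesis
    using assms by (simp add: powr_diff field_simps)
qed

lemma Gamma_midpoint_le:
  fixes x y :: real
  assumes "x > 0" "y > 0"
  shows "Gamma ((x + y) / 2) ^ 2 \<le> Gamma x * Gamma y"
proof -
  have pos: "Gamma ((x + y) / 2) > 0" "Gamma x > 0" "Gamma y > 0"
    using assms by (auto intro: Gamma_real_pos)
  have "ln (Gamma ((1 - 1/2) * x + 1/2 * y)) \<le> (1 - 1/2) * ln (Gamma x) + 1/2 * ln (Gamma y)"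
    using convex_onD[OF log_convex_Gamma_real, of "1/2" x y] assms by simp
  then have "2 * ln (Gamma ((x + y) / 2)) \<le> ln (Gamma x) + ln (Gamma y)"
    by (simp add: field_simps)
  then have "ln (Gamma ((x + y) / 2) ^ 2) \<le> ln (Gamma x * Gamma y)"
    using pos by (simp add: ln_mult ln_realpow)
  then show ?thesis
    using pos by (subst (asm) ln_le_cancel_iff) auto
qed

text \<open>Each application of the functional equation contributes a factor of at least 1/2. The
  threshold 1/2 is the least value of n + \<alpha> + 1 in the range considered, so the estimate is
  uniform in \<alpha>.\<close>

lemma Gamma_add_nat_ge:
  fixes z :: real
  assumes "z \<ge> 1/2"
  shows "Gamma z / 2 ^ j \<le> Gamma (z + real j)"
proof (induction j)
  case (Suc j)
  have "Gamma (z + real j) > 0"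
    using assms by (intro Gamma_real_pos) auto
  then have "1/2 * Gamma (z + real j) \<le> (z + real j) * Gamma (z + real j)"
    using assms by (intro mult_right_mono) auto
  also have "\<dots> = Gamma (z + real j + 1)"
    using assms by (intro Gamma_plus1[symmetric]) (auto elim!: nonpos_Ints_cases)
  finally show ?case
    using Suc by (simp add: add_ac)
qed simp

text \<open>Beyond some N the function is nonpositive, and what remains is a compact
  interval.\<close>

lemma continuous_at_bot_bounded_above:
  fixes f :: "real \<Rightarrow> real"
  assumes "continuous_on {a..} f" "filterlim f at_bot at_top"
  shows "\<exists>B. \<forall>x\<ge>a. f x \<le> B"
proof -
  obtain N where N: "\<And>x. x \<ge> N \<Longrightarrow> f x \<le> 0"
    using assms(2) unfolding filterlim_at_bot eventually_at_top_linorder by blast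
  have "bounded (f ` {a..N})"
    using assms(1) by (intro compact_imp_bounded compact_continuous_image)
      (auto intro: continuous_on_subset)
  then obtain C where C: "\<And>x. x \<in> {a..N} \<Longrightarrow> \<bar>f x\<bar> \<le> C"
    unfolding bounded_real by blast
  have "f x \<le> max 0 C" if "x \<ge> a" for x
    using N[of x] C[of x] that by (cases "x \<ge> N") fastforce+
  then show ?thesis by blast
qed

section \<open>Remainders of the Bessel series and of the kernel\<close>

text \<open>The factor \<open>sqrt t\<close> of the kernel raises each exponent 2m + \<alpha> by
  1/2, which makes it nonnegative for \<alpha> \<ge> -1/2. The powers are then nondecreasing in t >
  0 and bounded near 0.\<close>

lemma sqrt_mult_powr_half:
  assumes "t > 0"
  shows "sqrt t * (t / 2) powr \<beta> = sqrt 2 * (t / 2) powr (\<beta> + 1/2)"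
proof -
  have "sqrt t * (t / 2) powr \<beta> = sqrt 2 * (sqrt (t / 2) * (t / 2) powr \<beta>)"
    by (simp add: real_sqrt_divide)
  also have "sqrt (t / 2) * (t / 2) powr \<beta> = (t / 2) powr (\<beta> + 1/2)"
    using assms by (simp add: powr_add powr_half_sqrt)
  finally show ?thesis .
qed

definition bessel_term :: "real \<Rightarrow> nat \<Rightarrow> real \<Rightarrow> real" where
  "bessel_term \<alpha> m x = (-1) ^ m / fact m * ((x / 2) powr (2 * real m + \<alpha>) / Gamma (real m + \<alpha> + 1))"

text \<open>Both denominators are compared with those of term n: (j+n)! \<ge> n! j!, and the Gamma
  factor loses at most \<open>2 ^ j\<close>. This loss turns the natural ratio x^2/4 into x^2/2 and
  leaves a term of the exponential series.\<close>

lemma bessel_term_abs_le: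
  assumes "\<alpha> \<ge> -1/2" "x > 0"
  shows "\<bar>bessel_term \<alpha> (j + n) x\<bar> \<le>
    (x / 2) powr (2 * real n + \<alpha>) / (fact n * Gamma (real n + \<alpha> + 1)) * ((x\<^sup>2 / 2) ^ j / fact j)"
proof -
  have pos: "Gamma (real n + \<alpha> + 1) > 0" "Gamma (real (j + n) + \<alpha> + 1) > 0"
    using assms by (auto intro: Gamma_real_pos)
  have fact: "fact n * fact j \<le> (fact (j + n) :: real)"
  proof -
    have "fact n * fact j \<le> (fact (j + n) :: nat)"
      using fact_fact_dvd_fact[of n j] by (intro dvd_imp_le) (simp_all add: add.commute)
    then have "real (fact n * fact j) \<le> real (fact (j + n))"
      by (rule of_nat_mono)
    then show ?thesis by simp
  qed
  have Gamma: "Gamma (real n + \<alpha> + 1) / 2 ^ j \<le> Gamma (real (j + n) + \<alpha> + 1)"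
  proof -
    have "real (j + n) + \<alpha> + 1 = real n + \<alpha> + 1 + real j" by simp
    then show ?thesis
      using Gamma_add_nat_ge[of "real n + \<alpha> + 1" j] assms by (simp only:)
  qed
  have "(x / 2) powr (2 * real (j + n) + \<alpha>)
      = (x / 2) powr (2 * real n + \<alpha>) * (x / 2) powr real (2 * j)"
    by (subst powr_add[symmetric]) (simp add: algebra_simps)
  also have "(x / 2) powr real (2 * j) = (x\<^sup>2 / 4) ^ j"
    using assms by (subst powr_realpow) (auto simp: power_mult power_divide)
  finally have x: "(x / 2) powr (2 * real (j + n) + \<alpha>)
      = (x / 2) powr (2 * real n + \<alpha>) * (x\<^sup>2 / 4) ^ j" .
  have "\<bar>bessel_term \<alpha> (j + n) x\<bar>
      = (x / 2) powr (2 * real n + \<alpha>) * (x\<^sup>2 / 4) ^ j / (fact (j + n) * Gamma (real (j + n) + \<alpha> + 1))"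
    unfolding bessel_term_def x using pos by (simp add: abs_mult power_abs)
  also have "\<dots> \<le> (x / 2) powr (2 * real n + \<alpha>) * (x\<^sup>2 / 4) ^ j
      / ((fact n * fact j) * (Gamma (real n + \<alpha> + 1) / 2 ^ j))"
    using pos fact Gamma by (intro divide_left_mono mult_mono mult_nonneg_nonneg mult_pos_pos) auto
  also have "\<dots> = (x / 2) powr (2 * real n + \<alpha>) / (fact n * Gamma (real n + \<alpha> + 1))
      * ((x\<^sup>2 / 4) ^ j * 2 ^ j / fact j)"
    by (simp add: mult_ac)
  also have "(x\<^sup>2 / 4) ^ j * 2 ^ j = (x\<^sup>2 / 2) ^ j"
    by (simp flip: power_mult_distrib)
  finally show ?thesis .
qed

lemma bessel_J_remainder_le:
  assumes "\<alpha> \<ge> -1/2" "x > 0"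
  shows "\<bar>bessel_J \<alpha> x - (\<Sum>m<n. bessel_term \<alpha> m x)\<bar> \<le>
    (x / 2) powr (2 * real n + \<alpha>) / (fact n * Gamma (real n + \<alpha> + 1)) * exp (x\<^sup>2 / 2)"
proof -
  define C where "C n = (x / 2) powr (2 * real n + \<alpha>) / (fact n * Gamma (real n + \<alpha> + 1))" for n
  have sums: "(\<lambda>j. C n * ((x\<^sup>2 / 2) ^ j / fact j)) sums (C n * exp (x\<^sup>2 / 2))" for n
    using exp_converges[of "x\<^sup>2 / 2"] by (intro sums_mult) (simp only: real_scaleR_def divide_inverse_commute)
  have le: "norm (bessel_term \<alpha> (j + n) x) \<le> C n * ((x\<^sup>2 / 2) ^ j / fact j)" for j n
    using bessel_term_abs_le[OF assms] by (simp add: C_def)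
  \<comment> \<open>The comparison with n = 0 gives convergence of the whole Bessel series, which
    splitting off its first n terms presupposes.\<close>
  have "summable (\<lambda>j. bessel_term \<alpha> (j + 0) x)"
    by (rule summable_comparison_test'[OF sums_summable[OF sums[of 0]]]) (rule le)
  then have "bessel_J \<alpha> x - (\<Sum>m<n. bessel_term \<alpha> m x) = (\<Sum>j. bessel_term \<alpha> (j + n) x)"
    by (subst suminf_minus_initial_segment) (auto simp: bessel_J_def bessel_term_def)
  also have "\<bar>\<dots>\<bar> \<le> (\<Sum>j. C n * ((x\<^sup>2 / 2) ^ j / fact j))"
    using norm_suminf_le[OF le sums_summable[OF sums]] by simp
  also have "\<dots> = C n * exp (x\<^sup>2 / 2)"
    using sums[of n] by (simp add: sums_iff)
  finally show ?thesis by (simp add: C_def)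
qed

text \<open>The bound for the kernel minus its first n terms, evaluated at t = c, where it is
  largest on (0, c]. For n = 0 it bounds the kernel itself.\<close>

definition remainder_bound :: "real \<Rightarrow> real \<Rightarrow> nat \<Rightarrow> real" where
  "remainder_bound c \<alpha> n = sqrt 2 * exp (c\<^sup>2 / 2) * (c / 2) powr (2 * real n + \<alpha> + 1/2)
     / (fact n * Gamma (real n + \<alpha> + 1))"

lemma kernel_remainder_le:
  assumes "\<alpha> \<ge> -1/2" "0 < t" "t \<le> c"
  shows "\<bar>sqrt t * bessel_J \<alpha> t - (\<Sum>m<n. sqrt t * bessel_term \<alpha> m t)\<bar> \<le> remainder_bound c \<alpha> n"
proof -
  have pos: "Gamma (real n + \<alpha> + 1) > 0"
    using assms by (auto intro: Gamma_real_pos)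
  have "\<bar>sqrt t * bessel_J \<alpha> t - (\<Sum>m<n. sqrt t * bessel_term \<alpha> m t)\<bar>
      = sqrt t * \<bar>bessel_J \<alpha> t - (\<Sum>m<n. bessel_term \<alpha> m t)\<bar>"
    using assms by (simp add: abs_mult flip: sum_distrib_left right_diff_distrib)
  also have "\<dots> \<le> sqrt t * ((t / 2) powr (2 * real n + \<alpha>) / (fact n * Gamma (real n + \<alpha> + 1))
      * exp (t\<^sup>2 / 2))"
    using assms by (intro mult_left_mono bessel_J_remainder_le) auto
  also have "\<dots> = exp (t\<^sup>2 / 2) * (sqrt t * (t / 2) powr (2 * real n + \<alpha>))
      / (fact n * Gamma (real n + \<alpha> + 1))"
    by simp
  also have "sqrt t * (t / 2) powr (2 * real n + \<alpha>) = sqrt 2 * (t / 2) powr (2 * real n + \<alpha> + 1/2)"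
    using assms by (intro sqrt_mult_powr_half) simp
  also have "exp (t\<^sup>2 / 2) * (sqrt 2 * (t / 2) powr (2 * real n + \<alpha> + 1/2))
      / (fact n * Gamma (real n + \<alpha> + 1)) \<le> remainder_bound c \<alpha> n"
    unfolding remainder_bound_def mult.left_commute[of "exp _" "sqrt 2"] mult.assoc using assms pos
    by (intro divide_right_mono mult_mono powr_mono2 mult_nonneg_nonneg) auto
  finally show ?thesis .
qed

section \<open>Comparison of the remainder bound with the claimed decay\<close>

lemma remainder_bound_le:
  fixes c :: real
  assumes "c > 0"
  shows "\<exists>A>0. \<forall>\<alpha>\<ge>-1/2. \<forall>n. c * (remainder_bound c \<alpha> n)\<^sup>2 \<le>
           A * (exp 1 * c / (4 * real n + 2 * \<alpha> + 5)) powr (2 * real n + \<alpha> + 1)"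
proof -
  \<comment> \<open>With s = n + 1 + \<alpha>/2 and the lower bound for \<open>Gamma s\<close>
    inserted, \<open>h s\<close> is the logarithm of the squared remainder bound, without its
    prefactor \<open>2 * exp (c\<^sup>2)\<close>, divided by the claimed power. Its leading term is
    -2 s ln s. The range s \<ge> 3/4 corresponds to n \<ge> 0 and \<alpha> \<ge> -1/2.\<close>
  define h where "h s = (4 * s - 3) * ln (c / 2) + 4 * s + 4 * (1 - s) * ln s
           + (2 * s - 1) * (ln (4 * s + 1) - ln (exp 1 * c))" for s
  have "\<exists>B. \<forall>s\<ge>3/4. h s \<le> B"
  proof (rule continuous_at_bot_bounded_above)
    show "continuous_on {3/4..} h"
      unfolding h_def by (intro continuous_intros) auto
    show "filterlim h at_bot at_top"
      unfolding h_def by real_asymp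
  qed
  then obtain B where B: "\<And>s. s \<ge> 3/4 \<Longrightarrow> h s \<le> B" by blast
  define A where "A = 2 * c * exp (c\<^sup>2) * exp B"
  have "c * (remainder_bound c \<alpha> n)\<^sup>2 \<le>
           A * (exp 1 * c / (4 * real n + 2 * \<alpha> + 5)) powr (2 * real n + \<alpha> + 1)"
    if \<alpha>: "\<alpha> \<ge> -1/2" for \<alpha> n
  proof -
    define s where "s = real n + 1 + \<alpha> / 2"
    have s: "s \<ge> 3/4" using \<alpha> by (simp add: s_def)
    have G: "Gamma s > 0" "Gamma (real n + \<alpha> + 1) > 0"
      using s \<alpha> by (auto intro: Gamma_real_pos)
    have "(Gamma s)\<^sup>2 \<le> Gamma (real n + 1) * Gamma (real n + \<alpha> + 1)"
      using Gamma_midpoint_le[of "real n + 1" "real n + \<alpha> + 1"] \<alpha>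
      by (simp add: s_def add_divide_distrib add_ac)
    then have fG: "(Gamma s)\<^sup>2 \<le> fact n * Gamma (real n + \<alpha> + 1)"
      using Gamma_fact[of n, where 'a = real] by (simp add: add.commute)
    have "exp ((s - 1) * ln s - s) = s powr (s - 1) * exp (- s)"
      using s by (simp add: powr_def flip: exp_add)
    also have "\<dots> \<le> Gamma s"
      using s by (intro Gamma_ge_powr) simp
    finally have "(exp ((s - 1) * ln s - s))\<^sup>2 \<le> (Gamma s)\<^sup>2"
      by (intro power_mono) auto
    with fG have low: "exp (2 * ((s - 1) * ln s - s)) \<le> fact n * Gamma (real n + \<alpha> + 1)"
      by (simp flip: exp_double)
    have "remainder_bound c \<alpha> n \<le> sqrt 2 * exp (c\<^sup>2 / 2) * (c / 2) powr (2 * real n + \<alpha> + 1/2)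
     / exp (2 * ((s - 1) * ln s - s))"
      unfolding remainder_bound_def using low G by (intro divide_left_mono mult_pos_pos) auto
    also have "(c / 2) powr (2 * real n + \<alpha> + 1/2) = exp ((2 * s - 3/2) * ln (c / 2))"
      using assms by (simp add: powr_def s_def algebra_simps)
    also have "sqrt 2 * exp (c\<^sup>2 / 2) * exp ((2 * s - 3/2) * ln (c / 2)) / exp (2 * ((s - 1) * ln s - s))
       = sqrt 2 * exp (c\<^sup>2 / 2 + (2 * s - 3/2) * ln (c / 2) - 2 * ((s - 1) * ln s - s))"
      by (simp add: exp_add exp_diff)
    finally have "(remainder_bound c \<alpha> n)\<^sup>2 \<le>
        (sqrt 2 * exp (c\<^sup>2 / 2 + (2 * s - 3/2) * ln (c / 2) - 2 * ((s - 1) * ln s - s)))\<^sup>2"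
      using G by (intro power_mono) (auto simp: remainder_bound_def)
    also have "\<dots> = 2 * exp (2 * (c\<^sup>2 / 2 + (2 * s - 3/2) * ln (c / 2) - 2 * ((s - 1) * ln s - s)))"
      by (simp add: power_mult_distrib flip: exp_double)
    also have "2 * (c\<^sup>2 / 2 + (2 * s - 3/2) * ln (c / 2) - 2 * ((s - 1) * ln s - s))
      = c\<^sup>2 + h s + (2 * s - 1) * (ln (exp 1 * c) - ln (4 * s + 1))"
      by (simp add: h_def algebra_simps)
    also have "2 * exp \<dots> \<le> 2 * exp (c\<^sup>2 + B + (2 * s - 1) * (ln (exp 1 * c) - ln (4 * s + 1)))"
      using B[OF s] by simp
    also have "ln (exp 1 * c) - ln (4 * s + 1) = ln (exp 1 * c / (4 * s + 1))"
      using assms s by (subst ln_div) auto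
    also have "2 * exp (c\<^sup>2 + B + (2 * s - 1) * ln (exp 1 * c / (4 * s + 1))) =
        2 * exp (c\<^sup>2) * exp B * (exp 1 * c / (4 * s + 1)) powr (2 * s - 1)"
      using assms s by (simp add: powr_def exp_add)
    also have "4 * s + 1 = 4 * real n + 2 * \<alpha> + 5"
      by (simp add: s_def)
    also have "2 * s - 1 = 2 * real n + \<alpha> + 1"
      by (simp add: s_def)
    finally show ?thesis
      using assms by (simp add: A_def mult_left_mono mult.assoc)
  qed
  then show ?thesis
    using assms by (intro exI[of _ A]) (auto simp: A_def)
qed

section \<open>The inner product on \<open>L2_01\<close>\<close>

lemma square_integrable_01_mult:
  assumes "square_integrable_01 f" "square_integrable_01 g"
  shows "integrable lebesgue_01 (\<lambda>x. f x * g x)"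
proof (rule Bochner_Integration.integrable_bound)
  show "integrable lebesgue_01 (\<lambda>x. (f x)\<^sup>2 + (g x)\<^sup>2)"
    using assms by (auto simp: square_integrable_01_def)
  show "(\<lambda>x. f x * g x) \<in> borel_measurable lebesgue_01"
    using assms by (auto simp: square_integrable_01_def intro: borel_measurable_times)
  have "\<bar>f x * g x\<bar> \<le> (f x)\<^sup>2 + (g x)\<^sup>2" for x
    using sum_squares_bound[of "\<bar>f x\<bar>" "\<bar>g x\<bar>"] abs_ge_zero[of "f x * g x"]
    unfolding abs_mult mult.assoc power2_abs by linarith
  then show "AE x in lebesgue_01. norm (f x * g x) \<le> norm ((f x)\<^sup>2 + (g x)\<^sup>2)"
    by simp
qed

instantiation L2_01 :: real_inner
begin

lift_definition inner_L2_01 :: "L2_01 \<Rightarrow> L2_01 \<Rightarrow> real" is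
  "\<lambda>f g. LINT x|lebesgue_01. f x * g x"
proof -
  fix f1 f2 g1 g2 :: "real \<Rightarrow> real"
  assume *: "ae_eq_01 f1 f2" "ae_eq_01 g1 g2"
  then have [measurable]: "f1 \<in> borel_measurable lebesgue_01" "f2 \<in> borel_measurable lebesgue_01"
      "g1 \<in> borel_measurable lebesgue_01" "g2 \<in> borel_measurable lebesgue_01"
    by (auto simp: ae_eq_01_def square_integrable_01_def)
  have "AE x in lebesgue_01. f1 x = f2 x" "AE x in lebesgue_01. g1 x = g2 x"
    using * by (auto simp: ae_eq_01_def)
  then have "AE x in lebesgue_01. f1 x * g1 x = f2 x * g2 x"
    by eventually_elim simp
  then show "(LINT x|lebesgue_01. f1 x * g1 x) = (LINT x|lebesgue_01. f2 x * g2 x)"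
    by (intro integral_cong_AE) simp_all
qed

definition norm_L2_01 :: "L2_01 \<Rightarrow> real" where
  "norm_L2_01 f = sqrt (inner f f)"

definition sgn_L2_01 :: "L2_01 \<Rightarrow> L2_01" where
  "sgn_L2_01 f = f /\<^sub>R norm f"

definition dist_L2_01 :: "L2_01 \<Rightarrow> L2_01 \<Rightarrow> real" where
  "dist_L2_01 f g = norm (f - g)"

definition uniformity_L2_01 :: "(L2_01 \<times> L2_01) filter" where
  "uniformity_L2_01 = (INF e\<in>{0<..}. principal {(f, g). dist f g < e})"

definition open_L2_01 :: "L2_01 set \<Rightarrow> bool" where
  "open_L2_01 U = (\<forall>f\<in>U. \<forall>\<^sub>F (f', g) in uniformity. f' = f \<longrightarrow> g \<in> U)"

instance
proof
  fix f g h :: L2_01 and r :: real and U :: "L2_01 set"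
  show "dist f g = norm (f - g)"
    by (simp add: dist_L2_01_def)
  show "sgn f = f /\<^sub>R norm f"
    by (simp add: sgn_L2_01_def)
  show "uniformity = (INF e\<in>{0<..}. principal {(f, g). dist (f :: L2_01) g < e})"
    by (simp add: uniformity_L2_01_def)
  show "open U = (\<forall>f\<in>U. \<forall>\<^sub>F (f', g) in uniformity. f' = f \<longrightarrow> g \<in> U)"
    by (simp add: open_L2_01_def)
  show "norm f = sqrt (inner f f)"
    by (simp add: norm_L2_01_def)
  show "inner f g = inner g f"
    by transfer (simp add: mult.commute)
  show "inner (f + g) h = inner f h + inner g h"
    by transfer (simp add: ae_eq_01_def square_integrable_01_mult distrib_right)
  show "inner (r *\<^sub>R f) g = r * inner f g"
    by transfer (simp add: mult.assoc)
  show "0 \<le> inner f f"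
    by transfer simp
  show "inner f f = 0 \<longleftrightarrow> f = 0"
  proof transfer
    fix f :: "real \<Rightarrow> real"
    assume "ae_eq_01 f f"
    then show "(LINT x|lebesgue_01. f x * f x) = 0 \<longleftrightarrow> ae_eq_01 f (\<lambda>x. 0)"
      using integral_nonneg_eq_0_iff_AE[of lebesgue_01 "\<lambda>x. f x * f x"]
      by (simp add: ae_eq_01_def square_integrable_01_mult square_integrable_01_zero)
  qed
qed

end

lemma square_integrable_01_rep: "square_integrable_01 (rep_L2_01 f)"
  using Quotient3_rep_reflp[OF Quotient3_L2_01, of f] by (simp add: ae_eq_01_def)

lemma abs_rep_L2_01: "abs_L2_01 (rep_L2_01 f) = f"
  by (rule Quotient3_abs_rep[OF Quotient3_L2_01])

lemma abs_L2_01_eqI: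
  assumes "square_integrable_01 f" "square_integrable_01 g" "\<And>x. 0 < x \<Longrightarrow> x < 1 \<Longrightarrow> f x = g x"
  shows "abs_L2_01 f = abs_L2_01 g"
proof (rule Quotient3_rel_abs[OF Quotient3_L2_01])
  have "AE x in lebesgue_01. f x = g x"
    using assms(3) by (intro AE_I2) simp
  then show "ae_eq_01 f g"
    using assms by (simp add: ae_eq_01_def)
qed

lemma inner_abs_L2_01:
  assumes "square_integrable_01 f" "square_integrable_01 g"
  shows "inner (abs_L2_01 f) (abs_L2_01 g) = (LINT x|lebesgue_01. f x * g x)"
  using assms by (intro inner_L2_01.abs_eq) (auto simp: ae_eq_01_def)

lemma inner_abs_L2_01_left:
  assumes "square_integrable_01 f"
  shows "inner (abs_L2_01 f) g = (LINT x|lebesgue_01. f x * rep_L2_01 g x)"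
  using inner_abs_L2_01[OF assms square_integrable_01_rep[of g]] by (simp add: abs_rep_L2_01)

lemma measure_lebesgue_01: "measure lebesgue_01 (space lebesgue_01) = 1"
  by (simp add: measure_restrict_space)

interpretation lebesgue_01: finite_measure lebesgue_01
  by (rule finite_measure_lebesgue_on) simp

interpretation lebesgue_01: pair_sigma_finite lebesgue_01 lebesgue_01
  by unfold_locales

text \<open>The interval has measure 1, so a pointwise bound passes to the norm without a further
  constant.\<close>

lemma bounded_square_integrable_01:
  assumes "f \<in> borel_measurable lebesgue_01" "\<And>x. 0 < x \<Longrightarrow> x < 1 \<Longrightarrow> \<bar>f x\<bar> \<le> M"
  shows "square_integrable_01 f" and "norm (abs_L2_01 f) \<le> M"
proof -
  have M: "M \<ge> 0"
    using assms(2)[of "1/2"] by simp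
  have le: "(f x)\<^sup>2 \<le> M\<^sup>2" if "x \<in> space lebesgue_01" for x
    using assms(2)[of x] that M by (intro abs_le_square_iff[THEN iffD1]) auto
  show sq: "square_integrable_01 f"
    unfolding square_integrable_01_def using assms(1) le
    by (auto intro!: lebesgue_01.integrable_const_bound[where B = "M\<^sup>2"] AE_I2)
  have "(norm (abs_L2_01 f))\<^sup>2 = (LINT x|lebesgue_01. (f x)\<^sup>2)"
    by (simp add: power2_norm_eq_inner inner_abs_L2_01[OF sq sq] flip: power2_eq_square)
  also have "\<dots> \<le> (LINT x|lebesgue_01. M\<^sup>2)"
    using sq le by (intro integral_mono) (auto simp: square_integrable_01_def)
  also have "\<dots> = M\<^sup>2"
    by (simp add: measure_lebesgue_01[simplified])
  finally show "norm (abs_L2_01 f) \<le> M"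
    using M by (rule power2_le_imp_le)
qed

lemma borel_measurable_lebesgue_01: "f \<in> borel_measurable borel \<Longrightarrow> f \<in> borel_measurable lebesgue_01"
  by (intro measurable_restrict_space1 measurable_completion) simp

lemma square_integrable_01_powr: "\<beta> \<ge> 0 \<Longrightarrow> square_integrable_01 (\<lambda>y. y powr \<beta>)"
  by (rule bounded_square_integrable_01[where M = 1])
    (auto intro!: borel_measurable_lebesgue_01 powr_le1)

section \<open>The finite Hankel transform as a bounded symmetric operator\<close>

definition hankel_kernel :: "real \<Rightarrow> real \<Rightarrow> real" where
  "hankel_kernel \<alpha> t = sqrt t * bessel_J \<alpha> t"

lemma hankel_integral_eq:
  "hankel_integral c \<alpha> f x = (LINT y|lebesgue_01. hankel_kernel \<alpha> (c * x * y) * f y)"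
  by (simp add: hankel_integral_def hankel_kernel_def)

lemma borel_measurable_hankel_kernel [measurable]: "hankel_kernel \<alpha> \<in> borel_measurable borel"
  unfolding hankel_kernel_def bessel_J_def by measurable

context
  fixes c \<alpha> :: real
  assumes c: "c > 0" and \<alpha>: "\<alpha> \<ge> -1/2"
begin

lemma kernel_argument_bounds:
  assumes "0 < x" "x < 1" "0 < y" "y < 1"
  shows "0 < c * x * y" "c * x * y \<le> c"
proof -
  show "0 < c * x * y"
    using assms c by simp
  have "x * y \<le> 1 * 1"
    using assms by (intro mult_mono) auto
  then show "c * x * y \<le> c"
    using c by (simp add: mult.assoc)
qed

lemma hankel_kernel_le:
  assumes "0 < x" "x < 1" "0 < y" "y < 1"
  shows "\<bar>hankel_kernel \<alpha> (c * x * y)\<bar> \<le> remainder_bound c \<alpha> 0"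
  using kernel_remainder_le[OF \<alpha> kernel_argument_bounds[OF assms], of 0] by (simp add: hankel_kernel_def)

lemma square_integrable_01_hankel_kernel:
  assumes "0 < x" "x < 1"
  shows "square_integrable_01 (\<lambda>y. hankel_kernel \<alpha> (c * x * y))"
proof (rule bounded_square_integrable_01(1))
  show "(\<lambda>y. hankel_kernel \<alpha> (c * x * y)) \<in> borel_measurable lebesgue_01"
    by (rule borel_measurable_lebesgue_01) measurable
  show "\<And>y. 0 < y \<Longrightarrow> y < 1 \<Longrightarrow> \<bar>hankel_kernel \<alpha> (c * x * y)\<bar> \<le> remainder_bound c \<alpha> 0"
    by (rule hankel_kernel_le[OF assms])
qed

text \<open>For fixed x the transform is the inner product of f with a section of the kernel.
  Linearity in the class f then comes from the inner product, although representatives are chosen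
  without regard to sums.\<close>

lemma hankel_integral_rep:
  assumes "0 < x" "x < 1"
  shows "hankel_integral c \<alpha> (rep_L2_01 f) x = inner (abs_L2_01 (\<lambda>y. hankel_kernel \<alpha> (c * x * y))) f"
  by (simp add: hankel_integral_eq inner_abs_L2_01_left[OF square_integrable_01_hankel_kernel[OF assms]])

lemma borel_measurable_hankel_kernel_pair [measurable]:
  "(\<lambda>(x, y). hankel_kernel \<alpha> (c * x * y)) \<in> borel_measurable (lebesgue_01 \<Otimes>\<^sub>M lebesgue_01)"
proof -
  have [measurable]: "(\<lambda>x. x) \<in> borel_measurable lebesgue_01"
    by (rule borel_measurable_lebesgue_01) simp
  show ?thesis by measurable
qed

lemma borel_measurable_hankel_integral:
  assumes [measurable]: "f \<in> borel_measurable lebesgue_01"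
  shows "hankel_integral c \<alpha> f \<in> borel_measurable lebesgue_01"
  unfolding hankel_integral_eq by measurable

text \<open>As functions of y, the first n terms of a kernel section are multiples of powers
  orthogonal to f. Removing them leaves the transform unchanged, and Cauchy-Schwarz applies to the
  uniformly small rest.\<close>

lemma norm_finite_hankel_le:
  assumes "\<And>m. m < n \<Longrightarrow> inner (abs_L2_01 (\<lambda>y. y powr (2 * real m + \<alpha> + 1/2))) f = 0"
  shows "square_integrable_01 (hankel_integral c \<alpha> (rep_L2_01 f))"
    and "norm (finite_hankel c \<alpha> f) \<le> remainder_bound c \<alpha> n * norm f"
proof -
  have meas: "hankel_integral c \<alpha> (rep_L2_01 f) \<in> borel_measurable lebesgue_01"
    using square_integrable_01_rep[of f]
    by (intro borel_measurable_hankel_integral) (simp add: square_integrable_01_def)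
  have bound: "\<bar>hankel_integral c \<alpha> (rep_L2_01 f) x\<bar> \<le> remainder_bound c \<alpha> n * norm f"
    if x: "0 < x" "x < 1" for x
  proof -
    define Y where "Y m = (\<lambda>y. y powr (2 * real m + \<alpha> + 1/2))" for m
    \<comment> \<open>For fixed x, term m of the kernel is \<open>d m * Y m y\<close>: the constants
      and the power of x go into \<open>d m\<close>.\<close>
    define d where "d m = (-1) ^ m / fact m / Gamma (real m + \<alpha> + 1)
      * (sqrt 2 * (c * x / 2) powr (2 * real m + \<alpha> + 1/2))" for m
    define R where "R y = hankel_kernel \<alpha> (c * x * y) - (\<Sum>m<n. d m * Y m y)" for y
    have summand: "sqrt (c * x * y) * bessel_term \<alpha> m (c * x * y) = d m * Y m y"
      if y: "0 < y" "y < 1" for m y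
    proof -
      define t where "t = c * x * y"
      have "t > 0" using kernel_argument_bounds[OF x y] by (simp add: t_def)
      then have "sqrt t * (t / 2) powr (2 * real m + \<alpha>) = sqrt 2 * (t / 2) powr (2 * real m + \<alpha> + 1/2)"
        by (rule sqrt_mult_powr_half)
      also have "t / 2 = (c * x / 2) * y"
        by (simp add: t_def)
      also have "\<dots> powr (2 * real m + \<alpha> + 1/2)
          = (c * x / 2) powr (2 * real m + \<alpha> + 1/2) * y powr (2 * real m + \<alpha> + 1/2)"
        by (rule powr_mult)
      finally have "sqrt t * ((c * x * y) / 2) powr (2 * real m + \<alpha>)
          = sqrt 2 * (c * x / 2) powr (2 * real m + \<alpha> + 1/2) * Y m y"
        by (simp add: t_def Y_def)
      then show ?thesis
        by (simp add: bessel_term_def d_def t_def)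
    qed
    have sqY: "square_integrable_01 (Y m)" for m
      unfolding Y_def using \<alpha> by (intro square_integrable_01_powr) auto
    have RM: "\<bar>R y\<bar> \<le> remainder_bound c \<alpha> n" if "0 < y" "y < 1" for y
      using kernel_remainder_le[OF \<alpha> kernel_argument_bounds[OF x that], of n] by (simp add: R_def hankel_kernel_def summand[OF that])
    have Rmeas: "R \<in> borel_measurable lebesgue_01"
      unfolding R_def Y_def by (rule borel_measurable_lebesgue_01) measurable
    note R = bounded_square_integrable_01[OF Rmeas RM]
    have intY: "integrable lebesgue_01 (\<lambda>y. d m * (Y m y * rep_L2_01 f y))" for m
      using square_integrable_01_mult[OF sqY square_integrable_01_rep] by simp
    have "inner (abs_L2_01 R) f = (LINT y|lebesgue_01. hankel_kernel \<alpha> (c * x * y) * rep_L2_01 f y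
        - (\<Sum>m<n. d m * (Y m y * rep_L2_01 f y)))"
      by (simp add: inner_abs_L2_01_left[OF R(1)] R_def algebra_simps sum_distrib_left)
    also have "\<dots> = hankel_integral c \<alpha> (rep_L2_01 f) x
        - (\<Sum>m<n. LINT y|lebesgue_01. d m * (Y m y * rep_L2_01 f y))"
      using intY square_integrable_01_mult[OF square_integrable_01_hankel_kernel[OF x] square_integrable_01_rep]
      by (subst Bochner_Integration.integral_diff) (auto simp: hankel_integral_eq)
    also have "(\<Sum>m<n. LINT y|lebesgue_01. d m * (Y m y * rep_L2_01 f y))
        = (\<Sum>m<n. d m * inner (abs_L2_01 (Y m)) f)"
      by (simp add: inner_abs_L2_01_left[OF sqY])
    also have "\<dots> = 0"
      using assms by (intro sum.neutral ballI) (simp add: Y_def)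
    finally have "hankel_integral c \<alpha> (rep_L2_01 f) x = inner (abs_L2_01 R) f"
      by simp
    also have "\<bar>\<dots>\<bar> \<le> norm (abs_L2_01 R) * norm f"
      by (rule Cauchy_Schwarz_ineq2)
    also have "\<dots> \<le> remainder_bound c \<alpha> n * norm f"
      using R(2) by (intro mult_right_mono) auto
    finally show ?thesis .
  qed
  show "square_integrable_01 (hankel_integral c \<alpha> (rep_L2_01 f))"
    by (rule bounded_square_integrable_01(1)[OF meas bound])
  show "norm (finite_hankel c \<alpha> f) \<le> remainder_bound c \<alpha> n * norm f"
    unfolding finite_hankel_def by (rule bounded_square_integrable_01(2)[OF meas bound])
qed

text \<open>For n = 0 the orthogonality condition is empty, so the transform of every class is
  square integrable.\<close>

lemmas square_integrable_01_hankel_integral = norm_finite_hankel_le(1)[of 0, simplified]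

lemma linear_finite_hankel: "linear (finite_hankel c \<alpha>)"
proof (rule linearI)
  note sq = square_integrable_01_hankel_integral
  fix f g :: L2_01 and r :: real
  have "finite_hankel c \<alpha> f + finite_hankel c \<alpha> g = abs_L2_01
      (\<lambda>x. hankel_integral c \<alpha> (rep_L2_01 f) x + hankel_integral c \<alpha> (rep_L2_01 g) x)"
    unfolding finite_hankel_def using sq by (intro plus_L2_01.abs_eq) (simp_all add: ae_eq_01_def)
  also have "\<dots> = finite_hankel c \<alpha> (f + g)"
    unfolding finite_hankel_def
    by (intro abs_L2_01_eqI square_integrable_01_add sq) (simp add: hankel_integral_rep inner_add_right)
  finally show "finite_hankel c \<alpha> (f + g) = finite_hankel c \<alpha> f + finite_hankel c \<alpha> g" ..
  have "r *\<^sub>R finite_hankel c \<alpha> f = abs_L2_01 (\<lambda>x. r * hankel_integral c \<alpha> (rep_L2_01 f) x)"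
    unfolding finite_hankel_def using sq by (intro scaleR_L2_01.abs_eq) (simp_all add: ae_eq_01_def)
  also have "\<dots> = finite_hankel c \<alpha> (r *\<^sub>R f)"
    unfolding finite_hankel_def
    by (intro abs_L2_01_eqI square_integrable_01_cmult sq) (simp add: hankel_integral_rep)
  finally show "finite_hankel c \<alpha> (r *\<^sub>R f) = r *\<^sub>R finite_hankel c \<alpha> f" ..
qed

text \<open>The kernel depends on x and y only through their product, so exchanging the integrals
  exchanges f and g. Fubini applies because the integrand is dominated by a constant times |u(y)|
  |v(x)|.\<close>

lemma finite_hankel_symmetric: "inner (finite_hankel c \<alpha> f) g = inner f (finite_hankel c \<alpha> g)"
proof -
  define u v where "u = rep_L2_01 f" and "v = rep_L2_01 g"
  have sq: "square_integrable_01 u" "square_integrable_01 v"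
    by (simp_all add: u_def v_def square_integrable_01_rep)
  then have [measurable]: "u \<in> borel_measurable lebesgue_01" "v \<in> borel_measurable lebesgue_01"
    by (simp_all add: square_integrable_01_def)
  \<comment> \<open>Products with the constant 1 show that u and v are integrable.\<close>
  have sq1: "square_integrable_01 (\<lambda>_. 1)"
    by (rule bounded_square_integrable_01[where M = 1]) auto
  have int: "integrable lebesgue_01 (\<lambda>x. \<bar>u x\<bar>)" "integrable lebesgue_01 (\<lambda>x. \<bar>v x\<bar>)"
    using square_integrable_01_mult[OF sq(1) sq1] square_integrable_01_mult[OF sq(2) sq1] by auto
  define M where "M = remainder_bound c \<alpha> 0"
  define F where "F x y = hankel_kernel \<alpha> (c * x * y) * u y * v x" for x y
  have F [measurable]: "case_prod F \<in> borel_measurable (lebesgue_01 \<Otimes>\<^sub>M lebesgue_01)"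
    unfolding F_def by measurable
  have FM: "\<bar>F x y\<bar> \<le> M * \<bar>u y\<bar> * \<bar>v x\<bar>" if "0 < x" "x < 1" "0 < y" "y < 1" for x y
    unfolding F_def abs_mult M_def using hankel_kernel_le[OF that] by (intro mult_right_mono) auto
  have Fint: "integrable lebesgue_01 (F x)" if x: "0 < x" "x < 1" for x
  proof (rule Bochner_Integration.integrable_bound)
    show "integrable lebesgue_01 (\<lambda>y. M * \<bar>u y\<bar> * \<bar>v x\<bar>)"
      using int by simp
    show "AE y in lebesgue_01. norm (F x y) \<le> norm (M * \<bar>u y\<bar> * \<bar>v x\<bar>)"
      using FM[OF x] by (intro AE_I2) (fastforce intro: order_trans)
    show "F x \<in> borel_measurable lebesgue_01"
      using measurable_Pair2[OF F, of x] x by simp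
  qed
  have "integrable (lebesgue_01 \<Otimes>\<^sub>M lebesgue_01) (case_prod F)"
  proof (rule lebesgue_01.Fubini_integrable[OF F])
    show "AE x in lebesgue_01. integrable lebesgue_01 (\<lambda>y. case (x, y) of (x, y) \<Rightarrow> F x y)"
      using Fint by (intro AE_I2) simp
    show "integrable lebesgue_01 (\<lambda>x. LINT y|lebesgue_01. norm (case (x, y) of (x, y) \<Rightarrow> F x y))"
    proof (rule Bochner_Integration.integrable_bound)
      show "integrable lebesgue_01 (\<lambda>x. M * (LINT y|lebesgue_01. \<bar>u y\<bar>) * \<bar>v x\<bar>)"
        using int by simp
      show "(\<lambda>x. LINT y|lebesgue_01. norm (case (x, y) of (x, y) \<Rightarrow> F x y)) \<in> borel_measurable lebesgue_01"
        by measurable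
      have "(LINT y|lebesgue_01. \<bar>F x y\<bar>) \<le> M * (LINT y|lebesgue_01. \<bar>u y\<bar>) * \<bar>v x\<bar>"
        if x: "0 < x" "x < 1" for x
      proof -
        have "(LINT y|lebesgue_01. \<bar>F x y\<bar>) \<le> (LINT y|lebesgue_01. M * \<bar>u y\<bar> * \<bar>v x\<bar>)"
          using Fint[OF x] int FM[OF x] by (intro integral_mono) auto
        then show ?thesis by simp
      qed
      moreover have "(LINT y|lebesgue_01. \<bar>F x y\<bar>) \<ge> 0" for x
        by simp
      ultimately show "AE x in lebesgue_01. norm (LINT y|lebesgue_01. norm (case (x, y) of (x, y) \<Rightarrow> F x y))
          \<le> norm (M * (LINT y|lebesgue_01. \<bar>u y\<bar>) * \<bar>v x\<bar>)"
        by (intro AE_I2) (fastforce intro: order_trans)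
    qed
  qed
  note Fubini = lebesgue_01.Fubini_integral[OF this]
  have "inner (finite_hankel c \<alpha> f) g = (LINT x|lebesgue_01. hankel_integral c \<alpha> u x * v x)"
    unfolding finite_hankel_def u_def v_def
    by (rule inner_abs_L2_01_left[OF square_integrable_01_hankel_integral])
  also have "\<dots> = (LINT x|lebesgue_01. LINT y|lebesgue_01. F x y)"
    by (simp add: hankel_integral_eq F_def)
  also have "\<dots> = (LINT y|lebesgue_01. LINT x|lebesgue_01. F x y)"
    by (rule Fubini[symmetric])
  also have "\<dots> = (LINT y|lebesgue_01. hankel_integral c \<alpha> v y * u y)"
    by (simp add: hankel_integral_eq F_def mult_ac flip: integral_mult_right_zero integral_mult_left_zero)
  also have "\<dots> = inner (finite_hankel c \<alpha> g) f"
    unfolding finite_hankel_def u_def v_def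
    by (rule inner_abs_L2_01_left[OF square_integrable_01_hankel_integral, symmetric])
  finally show ?thesis
    by (simp add: inner_commute)
qed

text \<open>The min-max bound is applied to the functionals pairing f with the powers from the
  Bessel series. By symmetry the quadratic form of \<open>hankel_Q\<close> is c times the squared
  norm of the transform.\<close>

lemma hankel_Q_eigenvalue_le:
  assumes "eigenvalue_sequence (hankel_Q c \<alpha>) ev"
  shows "ev n \<le> c * (remainder_bound c \<alpha> n)\<^sup>2"
proof (rule eigenvalue_sequence_le[OF _ _ assms])
  show "linear (hankel_Q c \<alpha>)"
    unfolding hankel_Q_def
    using linear_finite_hankel by (intro linearI) (simp_all add: linear_add linear_scale scaleR_add_right)
  show "inner (hankel_Q c \<alpha> f) g = inner f (hankel_Q c \<alpha> g)" for f g
    by (simp add: hankel_Q_def finite_hankel_symmetric)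
  show "linear (\<lambda>f. inner (abs_L2_01 (\<lambda>y. y powr (2 * real m + \<alpha> + 1/2))) f)" for m
    by (intro linearI) (simp_all add: inner_add_right)
  show "inner (hankel_Q c \<alpha> f) f \<le> c * (remainder_bound c \<alpha> n)\<^sup>2 * inner f f"
    if "\<And>m. m < n \<Longrightarrow> inner (abs_L2_01 (\<lambda>y. y powr (2 * real m + \<alpha> + 1/2))) f = 0" for f
  proof -
    have "inner (hankel_Q c \<alpha> f) f = c * (norm (finite_hankel c \<alpha> f))\<^sup>2"
      by (simp add: hankel_Q_def finite_hankel_symmetric power2_norm_eq_inner)
    also have "\<dots> \<le> c * (remainder_bound c \<alpha> n * norm f)\<^sup>2"
      using c norm_finite_hankel_le(2)[OF that] by (intro mult_left_mono power_mono) auto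
    finally show ?thesis
      by (simp add: power_mult_distrib power2_norm_eq_inner)
  qed
qed

end

theorem theorem2:
  fixes c :: real
  assumes "c > 0"
  shows "\<exists>A>0. \<forall>\<alpha>\<ge>-1/2. \<forall>ev. eigenvalue_sequence (hankel_Q c \<alpha>) ev \<longrightarrow>
           (\<forall>n. real n > exp 1 * c / 4 \<longrightarrow>
              ev n \<le> A * (exp 1 * c / (4 * real n + 2 * \<alpha> + 5)) powr (2 * real n + \<alpha> + 1))"
  \<comment> \<open>A is obtained before \<alpha>, \<open>ev\<close> and n are chosen, so it depends
    on c alone.\<close>
  using remainder_bound_le[OF assms] hankel_Q_eigenvalue_le[OF assms] by (meson order_trans)

end
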